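(* Consider the scan-and-move sensing model, second-order estimator, confidence sets, and partial-arc scan strategy described in the context, with maximum scan angle $\bar\alpha\in(0,2\pi)$, integer $m\ge5$ and $\lambda>0$. Fix $\varepsilon>0$, $\eta\in(0,1)$, and $\delta_k\in(0,1)$. If the scan parameters satisfy $$\overline\varrho_m(\bar\alpha,\delta_k)\leq\frac{(1-\eta)\varepsilon}{4},$$ then, on the event that $\nabla F(p_k)\in\mathcal C_{k,n}$ for all $n\geq1$ (gradient expressed in the episode-local frame), episode $k$ satisfies one of the two conditions $$\gamma^+_{k,n}\leq\varepsilon\qquad\text{or}\qquad\gamma^-_{k,n}\geq\eta\gamma^+_{k,n}$$ by sample $m$ (i.e. for some $n\le m$). Hence the stopping time satisfies $\tau_k\leq m$, and the total scan angle is at most $\bar\alpha<2\pi$.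
   Context: Field assumption: $F:\mathbb{R}^2\to\mathbb{R}$ is $C^3$, has a unique global minimizer $p^\star$, which is its only stationary point; $\{p:F(p)\le F(p_0)\}$ is compact for the initial position $p_0$; there are known constants $G,L,M_3>0$ with $\|\nabla F(p)\|\le G$, $\|\nabla F(p)-\nabla F(\bar p)\|\le L\|p-\bar p\|$, $\|D^3F(p)\|\le M_3$ (operator norm of the trilinear form) for all $p,\bar p\in\mathbb{R}^2$; and $F(p_0)-F(p^\star)\le\Delta_0$ for a known $\Delta_0>0$. Sensing model: write $\varphi(\theta)=[\cos\theta\ \ \sin\theta]^\top$. A scalar sensor is mounted at distance $\rho>0$ from the robot center. During the scan of episode $k$ the robot center is fixed at $p_k$, with heading $\theta_k$ at the start of the episode. The $i$th measurement, at relative bearing $\alpha_{k,i}$, is $\mathsf{y}_{k,i}=F(p_k+\rho\varphi(\theta_k+\alpha_{k,i}))+w_{k,i}$. With $\mathcal F_{k,i}$ the information generated by all relative bearings and measurements up to sample $i$ of episode $k$ (including previous episodes), the noise satisfies $\mathbb{E}[w_{k,i}\mid\mathcal F_{k,i-1}]=0$ and $\mathbb{E}[e^{s w_{k,i}}\mid\mathcal F_{k,i-1}]\le\exp(s^2\sigma^2/2)$ for all $s\in\mathbb{R}$, with known variance proxy $\sigma^2$, and $\alpha_{k,i}$ is $\mathcal F_{k,i-1}$-measurable. The episode-local frame is the frame centered at $p_k$ rotated by $\theta_k$; the gradient in this frame is $R(\theta_k)^\top\nabla F(p_k)$, with $R(\theta)$ the counterclockwise rotation matrix. Estimator: $z(\alpha)=[\cos\alpha\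 \sin\alpha\ \cos2\alpha\ \sin2\alpha]^\top$, $\psi_{k,1}=e_1=[1\ 0\ 0\ 0\ 0]^\top$, $\psi_{k,i}=\begin{bmatrix}1\\ z(\alpha_{k,i})-z(\alpha_{k,1})\end{bmatrix}\in\mathbb{R}^5$ for $i\ge2$; $\Lambda_\lambda=\operatorname{diag}(0,\lambda I_4)$, $V_{k,n}=\Lambda_\lambda+\sum_{i=1}^n\psi_{k,i}\psi_{k,i}^\top$, $\hat\vartheta_{k,n}=V_{k,n}^{-1}\sum_{i=1}^n\psi_{k,i}\mathsf{y}_{k,i}$; $G_\rho=\frac1\rho[0\ \ I_2\ \ 0_{2\times2}]\in\mathbb{R}^{2\times5}$, $\hat g_{k,n}=G_\rho\hat\vartheta_{k,n}$, $P_{k,n}=G_\rho V_{k,n}^{-1}G_\rho^\top$. Confidence set: $S_\xi=\sqrt{\rho^2G^2+\rho^4L^2/4}$, $b_\rho=M_3\rho^3/6$, $$\beta_{k,n}=\sigma\sqrt{2\log\frac{4}{\delta_k}}+\sigma\sqrt{2\log\!\left(\frac{2\det(V_{k,n})^{1/2}}{\delta_k\det(V_{k,1})^{1/2}}\right)}+\sqrt{\lambda}\,S_\xi+b_\rho\sqrt n,$$ $$\mathcal C_{k,n}=\{g\in\mathbb{R}^2:(g-\hat g_{k,n})^\top P_{k,n}^{-1}(g-\hat g_{k,n})\le\beta_{k,n}^2\},$$ $\gamma^-_{k,n}=\min_{g\in\mathcal C_{k,n}}\|g\|$, $\gamma^+_{k,n}=\max_{g\in\mathcal C_{k,n}}\|g\|$.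 Scan strategy: the candidate relative bearings are $\alpha_{k,i}=\frac{i-1}{m-1}\bar\alpha$, $i=1,\dots,m$. After every measurement the two conditions $\gamma^+_{k,n}\le\varepsilon$ and $\gamma^-_{k,n}\ge\eta\gamma^+_{k,n}$ are checked; the scan stops at the first sample $n=\tau_k$ at which at least one holds. Since only $m$ bearings are prescribed, "for all $n\ge1$" refers to the sample sizes $n=1,\dots,m$ of the candidate schedule. Design quantities (deterministic): $\Psi_m(\bar\alpha)\in\mathbb{R}^{m\times5}$ has as rows the $\psi_{k,i}^\top$, $i=1,\dots,m$, evaluated at the bearings $\alpha_{k,i}=\frac{i-1}{m-1}\bar\alpha$; $V_m(\bar\alpha)=\Lambda_\lambda+\Psi_m^\top\Psi_m$, $V_1=\operatorname{diag}(1,\lambda I_4)$, $\kappa_m(\bar\alpha)=\lambda_{\min}(\frac1m\Psi_m^\top\Psi_m)$ (which is positive), $D_m(\bar\alpha)=\det V_m(\bar\alpha)/\det V_1$. For $\delta'\in(0,1)$, $$\overline\beta_m(\bar\alpha,\delta')=\sigma\sqrt{2\log\frac{4}{\delta'}}+\sigma\sqrt{2\log\!\left(\frac{2D_m(\bar\alpha)^{1/2}}{\delta'}\right)}+\sqrt{\lambda}\,S_\xi+b_\rho\sqrt m,$$ $$\overline\varrho_m(\bar\alpha,\delta')=\frac{\overline\beta_m(\bar\alpha,\delta')}{\rho\sqrt{m\,\kappa_m(\bar\alpha)}}.$$ *)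

theory Defs
  imports "HOL-Probability.Probability"
begin

section \<open>The field\<close>

definition grad :: "(real^2 \<Rightarrow> real) \<Rightarrow> real^2 \<Rightarrow> real^2" where
  "grad F p = (THE g. GDERIV F p :> g)"

text \<open>Bounded linear maps carry the operator norm, so \<open>norm (D3 p)\<close> below is the operator norm
  of the trilinear form \<open>D\<^sup>3F(p)\<close>.\<close>

definition C3_derivs ::
  "(real^2 \<Rightarrow> real) \<Rightarrow> (real^2 \<Rightarrow> ((real^2) \<Rightarrow>\<^sub>L real)) \<Rightarrow>
   (real^2 \<Rightarrow> ((real^2) \<Rightarrow>\<^sub>L (real^2) \<Rightarrow>\<^sub>L real)) \<Rightarrow>
   (real^2 \<Rightarrow> ((real^2) \<Rightarrow>\<^sub>L (real^2) \<Rightarrow>\<^sub>L (real^2) \<Rightarrow>\<^sub>L real)) \<Rightarrow> bool" where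
  "C3_derivs F D1 D2 D3 \<longleftrightarrow>
     (\<forall>p. (F has_derivative blinfun_apply (D1 p)) (at p)) \<and>
     (\<forall>p. (D1 has_derivative blinfun_apply (D2 p)) (at p)) \<and>
     (\<forall>p. (D2 has_derivative blinfun_apply (D3 p)) (at p)) \<and>
     continuous_on UNIV D3"

text \<open>The known constants: sensor offset \<open>\<rho>\<close>, \<open>\<sigma>\<close> (square root of the variance proxy),
  regularization \<open>\<lambda>\<close>, and the bounds \<open>G\<close>, \<open>L\<close>, \<open>M\<^sub>3\<close>.\<close>

record params =
  rho :: real
  sig :: real
  lam :: real
  Gbd :: real
  Lbd :: real
  M3bd :: real

locale field_model =
  fixes F :: "real^2 \<Rightarrow> real" and p0 pstar :: "real^2" and \<Delta>0 :: real and c :: params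
  assumes C3: "\<exists>D1 D2 D3. C3_derivs F D1 D2 D3 \<and> (\<forall>p. norm (D3 p) \<le> M3bd c)"
    and consts_pos: "0 < Gbd c" "0 < Lbd c" "0 < M3bd c" "0 < \<Delta>0"
    and unique_minimizer: "\<And>q. q \<noteq> pstar \<Longrightarrow> F pstar < F q"
    and stationary_iff: "\<And>q. grad F q = 0 \<longleftrightarrow> q = pstar"
    and compact_sublevel: "compact {q. F q \<le> F p0}"
    and grad_bounded: "\<And>q. norm (grad F q) \<le> Gbd c"
    and grad_lipschitz: "\<And>q q'. norm (grad F q - grad F q') \<le> Lbd c * norm (q - q')"
    and initial_gap: "F p0 - F pstar \<le> \<Delta>0"

section \<open>Estimator and confidence sets within one episode\<close>

text \<open>Below, \<open>a i\<close> and \<open>y i\<close> are the relative bearing and the measurement of the \<open>i\<close>th sample of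
  one episode, for \<open>i \<ge> 1\<close>. Row and column \<open>1\<close> belong to the constant regressor.\<close>

definition phi :: "real \<Rightarrow> real^2" where
  "phi t = vector [cos t, sin t]"

definition rot :: "real \<Rightarrow> real^2^2" where
  "rot t = vector [vector [cos t, - sin t], vector [sin t, cos t]]"

definition outer :: "real^'n \<Rightarrow> real^'n^'n" where
  "outer v = (\<chi> i j. v $ i * v $ j)"

definition zfeat :: "real \<Rightarrow> real^4" where
  "zfeat t = vector [cos t, sin t, cos (2 * t), sin (2 * t)]"

definition psi :: "(nat \<Rightarrow> real) \<Rightarrow> nat \<Rightarrow> real^5" where
  "psi a i = (if i = 1 then vector [1, 0, 0, 0, 0]
     else (let d = zfeat (a i) - zfeat (a 1) in vector [1, d $ 1, d $ 2, d $ 3, d $ 4]))"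

definition Lam :: "real \<Rightarrow> real^5^5" where
  "Lam l = (\<chi> i j. if i = j \<and> i \<noteq> 1 then l else 0)"

text \<open>\<open>gram a n\<close> is \<open>\<Psi>\<^sup>T \<Psi>\<close> for the \<open>n \<times> 5\<close> matrix \<open>\<Psi>\<close> with rows \<open>psi a 1, \<dots>, psi a n\<close>; writing it
  as a sum avoids a matrix whose number of rows depends on \<open>n\<close>.\<close>

definition gram :: "(nat \<Rightarrow> real) \<Rightarrow> nat \<Rightarrow> real^5^5" where
  "gram a n = (\<Sum>i = 1..n. outer (psi a i))"

definition Vmat :: "params \<Rightarrow> (nat \<Rightarrow> real) \<Rightarrow> nat \<Rightarrow> real^5^5" where
  "Vmat c a n = Lam (lam c) + gram a n"

definition param_est :: "params \<Rightarrow> (nat \<Rightarrow> real) \<Rightarrow> (nat \<Rightarrow> real) \<Rightarrow> nat \<Rightarrow> real^5" where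
  "param_est c a y n = matrix_inv (Vmat c a n) *v (\<Sum>i = 1..n. y i *\<^sub>R psi a i)"

definition Gmat :: "params \<Rightarrow> real^5^2" where
  "Gmat c = (1 / rho c) *\<^sub>R vector [vector [0, 1, 0, 0, 0], vector [0, 0, 1, 0, 0]]"

definition grad_est :: "params \<Rightarrow> (nat \<Rightarrow> real) \<Rightarrow> (nat \<Rightarrow> real) \<Rightarrow> nat \<Rightarrow> real^2" where
  "grad_est c a y n = Gmat c *v param_est c a y n"

definition Pmat :: "params \<Rightarrow> (nat \<Rightarrow> real) \<Rightarrow> nat \<Rightarrow> real^2^2" where
  "Pmat c a n = Gmat c ** matrix_inv (Vmat c a n) ** transpose (Gmat c)"

definition S_xi :: "params \<Rightarrow> real" where
  "S_xi c = sqrt ((rho c)\<^sup>2 * (Gbd c)\<^sup>2 + rho c ^ 4 * (Lbd c)\<^sup>2 / 4)"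

definition b_rho :: "params \<Rightarrow> real" where
  "b_rho c = M3bd c * rho c ^ 3 / 6"

definition beta :: "params \<Rightarrow> real \<Rightarrow> (nat \<Rightarrow> real) \<Rightarrow> nat \<Rightarrow> real" where
  "beta c d a n =
     sig c * sqrt (2 * ln (4 / d))
     + sig c * sqrt (2 * ln (2 * sqrt (det (Vmat c a n)) / (d * sqrt (det (Vmat c a 1)))))
     + sqrt (lam c) * S_xi c + b_rho c * sqrt (real n)"

definition conf_set ::
  "params \<Rightarrow> real \<Rightarrow> (nat \<Rightarrow> real) \<Rightarrow> (nat \<Rightarrow> real) \<Rightarrow> nat \<Rightarrow> (real^2) set" where
  "conf_set c d a y n =
     {g. (g - grad_est c a y n) \<bullet> (matrix_inv (Pmat c a n) *v (g - grad_est c a y n))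
           \<le> (beta c d a n)\<^sup>2}"

definition gamma_minus ::
  "params \<Rightarrow> real \<Rightarrow> (nat \<Rightarrow> real) \<Rightarrow> (nat \<Rightarrow> real) \<Rightarrow> nat \<Rightarrow> real" where
  "gamma_minus c d a y n = (LEAST r. r \<in> norm ` conf_set c d a y n)"

definition gamma_plus ::
  "params \<Rightarrow> real \<Rightarrow> (nat \<Rightarrow> real) \<Rightarrow> (nat \<Rightarrow> real) \<Rightarrow> nat \<Rightarrow> real" where
  "gamma_plus c d a y n = (GREATEST r. r \<in> norm ` conf_set c d a y n)"

section \<open>Partial-arc scan\<close>

definition bearing :: "nat \<Rightarrow> real \<Rightarrow> nat \<Rightarrow> real" where
  "bearing m abar i = (real i - 1) / (real m - 1) * abar"

definition stop_cond ::
  "params \<Rightarrow> real \<Rightarrow> real \<Rightarrow> real \<Rightarrow> (nat \<Rightarrow> real) \<Rightarrow> (nat \<Rightarrow> real) \<Rightarrow> nat \<Rightarrow> bool" where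
  "stop_cond c \<epsilon> \<eta> d a y n \<longleftrightarrow>
     gamma_plus c d a y n \<le> \<epsilon> \<or> gamma_minus c d a y n \<ge> \<eta> * gamma_plus c d a y n"

text \<open>The value is \<open>\<infinity>\<close> if neither condition holds at any of the \<open>m\<close> candidate samples.\<close>

definition stop_time ::
  "params \<Rightarrow> real \<Rightarrow> real \<Rightarrow> nat \<Rightarrow> real \<Rightarrow> (nat \<Rightarrow> real) \<Rightarrow> (nat \<Rightarrow> real) \<Rightarrow> enat" where
  "stop_time c \<epsilon> \<eta> m d a y = (INF n\<in>{n \<in> {1..m}. stop_cond c \<epsilon> \<eta> d a y n}. enat n)"

text \<open>Total rotation between the first and the \<open>n\<close>th sample.\<close>

definition scan_angle :: "(nat \<Rightarrow> real) \<Rightarrow> nat \<Rightarrow> real" where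
  "scan_angle a n = (\<Sum>i = 2..n. \<bar>a i - a (i - 1)\<bar>)"

section \<open>Sensing model\<close>

definition meas ::
  "(real^2 \<Rightarrow> real) \<Rightarrow> params \<Rightarrow> (nat \<Rightarrow> 'w \<Rightarrow> real^2) \<Rightarrow> (nat \<Rightarrow> 'w \<Rightarrow> real) \<Rightarrow>
   (nat \<Rightarrow> nat \<Rightarrow> 'w \<Rightarrow> real) \<Rightarrow> (nat \<Rightarrow> nat \<Rightarrow> 'w \<Rightarrow> real) \<Rightarrow> nat \<Rightarrow> nat \<Rightarrow> 'w \<Rightarrow> real" where
  "meas F c p \<theta> \<alpha> w k i \<omega> = F (p k \<omega> + rho c *\<^sub>R phi (\<theta> k \<omega> + \<alpha> k i \<omega>)) + w k i \<omega>"

text \<open>The information up to sample \<open>i\<close> of episode \<open>k\<close>. An earlier episode \<open>j\<close> contributes only the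
  samples taken before it stopped, whose number \<open>\<tau> j\<close> is random.\<close>

definition history ::
  "'w measure \<Rightarrow> nat \<Rightarrow> (nat \<Rightarrow> 'w \<Rightarrow> enat) \<Rightarrow> (nat \<Rightarrow> nat \<Rightarrow> 'w \<Rightarrow> real) \<Rightarrow>
   (nat \<Rightarrow> nat \<Rightarrow> 'w \<Rightarrow> real) \<Rightarrow> nat \<Rightarrow> nat \<Rightarrow> 'w measure" where
  "history M m \<tau> \<alpha> y k i = sigma (space M)
     ({{\<omega> \<in> space M. X k l \<omega> \<in> B} | X l B. X \<in> {\<alpha>, y} \<and> l \<in> {1..i} \<and> B \<in> sets borel} \<union>
      {{\<omega> \<in> space M. enat l \<le> \<tau> j \<omega> \<and> X j l \<omega> \<in> B} | X j l B.
          X \<in> {\<alpha>, y} \<and> j < k \<and> l \<in> {1..m} \<and> B \<in> sets borel})"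

locale scan_model = prob_space M + field_model F p0 pstar \<Delta>0 c
  for M :: "'w measure" and F p0 pstar \<Delta>0 c +
  fixes m :: nat and abar \<epsilon> \<eta> :: real and \<delta> :: "nat \<Rightarrow> real"
    and p :: "nat \<Rightarrow> 'w \<Rightarrow> real^2" and \<theta> :: "nat \<Rightarrow> 'w \<Rightarrow> real"
    and \<alpha> w :: "nat \<Rightarrow> nat \<Rightarrow> 'w \<Rightarrow> real"
    and y :: "nat \<Rightarrow> nat \<Rightarrow> 'w \<Rightarrow> real" and \<tau> :: "nat \<Rightarrow> 'w \<Rightarrow> enat"
    and H :: "nat \<Rightarrow> nat \<Rightarrow> 'w measure"
  assumes rho_pos: "0 < rho c"
    and sig_nonneg: "0 \<le> sig c"
    and p_init: "\<And>\<omega>. \<omega> \<in> space M \<Longrightarrow> p 0 \<omega> = p0"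
    and p_meas: "\<And>k. p k \<in> borel_measurable M"
    and heading_meas: "\<And>k. \<theta> k \<in> borel_measurable M"
    and y_eq: "y = meas F c p \<theta> \<alpha> w"
    and \<tau>_eq: "\<tau> = (\<lambda>k \<omega>. stop_time c \<epsilon> \<eta> m (\<delta> k) (\<lambda>i. \<alpha> k i \<omega>) (\<lambda>i. y k i \<omega>))"
    and H_eq: "H = history M m \<tau> \<alpha> y"
    and bearing_meas: "\<And>k i. i \<in> {1..m} \<Longrightarrow> \<alpha> k i \<in> borel_measurable (H k (i - 1))"
    and bearing_eq: "\<And>k i \<omega>. i \<in> {1..m} \<Longrightarrow> \<omega> \<in> space M \<Longrightarrow> \<alpha> k i \<omega> = bearing m abar i"
    and noise_integrable: "\<And>k i. i \<in> {1..m} \<Longrightarrow> integrable M (w k i)"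
    and noise_centered: "\<And>k i. i \<in> {1..m} \<Longrightarrow>
          AE \<omega> in M. real_cond_exp M (H k (i - 1)) (w k i) \<omega> = 0"
    and noise_exp_integrable: "\<And>k i s. i \<in> {1..m} \<Longrightarrow> integrable M (\<lambda>\<omega>. exp (s * w k i \<omega>))"
    and noise_subgaussian: "\<And>k i s. i \<in> {1..m} \<Longrightarrow>
          AE \<omega> in M. real_cond_exp M (H k (i - 1)) (\<lambda>\<omega>. exp (s * w k i \<omega>)) \<omega>
            \<le> exp (s\<^sup>2 * (sig c)\<^sup>2 / 2)"

section \<open>Design quantities\<close>

definition lambda_min :: "real^'n^'n \<Rightarrow> real" where
  "lambda_min A = (LEAST l. \<exists>v. v \<noteq> 0 \<and> A *v v = l *\<^sub>R v)"

definition V_one :: "params \<Rightarrow> real^5^5" where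
  "V_one c = (\<chi> i j. if i = j then (if i = 1 then 1 else lam c) else 0)"

definition kappa_m :: "nat \<Rightarrow> real \<Rightarrow> real" where
  "kappa_m m abar = lambda_min ((1 / real m) *\<^sub>R gram (bearing m abar) m)"

definition D_m :: "params \<Rightarrow> nat \<Rightarrow> real \<Rightarrow> real" where
  "D_m c m abar = det (Vmat c (bearing m abar) m) / det (V_one c)"

definition beta_bar :: "params \<Rightarrow> nat \<Rightarrow> real \<Rightarrow> real \<Rightarrow> real" where
  "beta_bar c m abar d =
     sig c * sqrt (2 * ln (4 / d)) + sig c * sqrt (2 * ln (2 * sqrt (D_m c m abar) / d))
     + sqrt (lam c) * S_xi c + b_rho c * sqrt (real m)"

definition rho_bar :: "params \<Rightarrow> nat \<Rightarrow> real \<Rightarrow> real \<Rightarrow> real" where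
  "rho_bar c m abar d = beta_bar c m abar d / (rho c * sqrt (real m * kappa_m m abar))"

end

theory Submission
  imports Defs
begin

text \<open>At sample \<open>m\<close> the confidence set is an ellipse. Since \<open>V \<ge> m \<kappa> I\<close>, it lies in a ball of radius
  \<open>r = \<beta> / (\<rho> sqrt (m \<kappa>))\<close>, hence \<open>\<gamma>\<^sup>+ - \<gamma>\<^sup>- \<le> 2 r \<le> (1 - \<eta>) \<epsilon>\<close>, and \<open>\<gamma>\<^sup>+ > \<epsilon>\<close> forces
  \<open>\<gamma>\<^sup>- \<ge> \<eta> \<gamma>\<^sup>+\<close>. Two facts keep junk values away: \<open>\<kappa> > 0\<close>, because a nonzero trigonometric polynomial
  of degree two has at most four zeros on \<open>[0, 2 \<pi>)\<close>, and \<open>\<beta> \<ge> 0\<close>, because the matrix determinant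
  lemma gives \<open>det V \<ge> det V\<^sub>1\<close>.\<close>

subsection \<open>Symmetric positive definite matrices\<close>

lemma matrix_inv_inverts:
  fixes A :: "'a::semiring_1^'n^'m"
  assumes "invertible A"
  shows "A ** matrix_inv A = mat 1" "matrix_inv A ** A = mat 1"
  using someI_ex[OF assms[unfolded invertible_def]] unfolding matrix_inv_def by auto

lemma invertible_iff_kernel_trivial:
  fixes A :: "real^'n^'n"
  shows "invertible A \<longleftrightarrow> (\<forall>x. A *v x = 0 \<longrightarrow> x = 0)"
  by (simp add: invertible_left_inverse matrix_left_invertible_ker)

lemma inner_symmetric_matrix:
  fixes A :: "real^'n^'n"
  assumes "transpose A = A"
  shows "x \<bullet> (A *v y) = y \<bullet> (A *v x)"
  by (metis assms dot_lmul_matrix inner_commute transpose_matrix_vector)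

lemma inner_outer: "x \<bullet> (outer u *v y) = (x \<bullet> u) * (u \<bullet> y)"
proof -
  have "outer u *v y = (u \<bullet> y) *\<^sub>R u"
    by (simp add: vec_eq_iff outer_def matrix_vector_mult_def inner_vec_def sum_distrib_left ac_simps)
  then show ?thesis
    by simp
qed

text \<open>If \<open>A *v v\<close> were nonzero, a small move from \<open>v\<close> against it
  would lower the form to first order, from zero to a negative value.\<close>

lemma psd_kernel:
  fixes A :: "real^'n^'n"
  assumes sym: "transpose A = A" and psd: "\<And>x. 0 \<le> x \<bullet> (A *v x)" and v: "v \<bullet> (A *v v) = 0"
  shows "A *v v = 0"
proof (rule ccontr)
  assume ne: "A *v v \<noteq> 0"
  define w where "w = A *v v"
  define q where "q = w \<bullet> (A *v w)"
  have w: "0 < w \<bullet> w" and q: "0 \<le> q"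
    using ne psd by (auto simp: w_def q_def)
  \<comment> \<open>The \<open>+ 1\<close> keeps the quotient meaningful when \<open>q = 0\<close>,
    and \<open>t * q\<close> still stays below twice the square of \<open>norm w\<close>.\<close>
  define t where "t = (w \<bullet> w) / (q + 1)"
  have t: "0 < t" using w q by (simp add: t_def)
  have "(v - t *\<^sub>R w) \<bullet> (A *v (v - t *\<^sub>R w)) = t * (t * q - 2 * (w \<bullet> w))"
  proof -
    have "A *v (v - t *\<^sub>R w) = w - t *\<^sub>R (A *v w)"
      by (simp add: matrix_vector_mult_diff_distrib matrix_vector_mult_scaleR w_def)
    moreover have "v \<bullet> (A *v w) = w \<bullet> w"
      by (metis inner_symmetric_matrix[OF sym] w_def)
    moreover have "v \<bullet> w = 0" using v by (simp add: w_def)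
    ultimately show ?thesis
      by (simp add: inner_diff_left inner_diff_right q_def algebra_simps)
  qed
  moreover have "t * q < 2 * (w \<bullet> w)"
  proof -
    have "t * q \<le> t * (q + 1)" using t by simp
    also have "\<dots> = w \<bullet> w" using q by (simp add: t_def)
    finally show ?thesis using w by linarith
  qed
  ultimately have "(v - t *\<^sub>R w) \<bullet> (A *v (v - t *\<^sub>R w)) < 0"
    using t by (simp add: mult_pos_neg)
  with psd[of "v - t *\<^sub>R w"] show False by simp
qed

text \<open>The minimiser of the quadratic form on the unit sphere is an eigenvector for the smallest
  eigenvalue.\<close>

lemma lambda_min_symmetric:
  fixes A :: "real^'n^'n"
  assumes sym: "transpose A = A"
  shows lambda_min_eigenvector: "\<exists>v. norm v = 1 \<and> A *v v = lambda_min A *\<^sub>R v"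
    and lambda_min_le: "lambda_min A * (x \<bullet> x) \<le> x \<bullet> (A *v x)"
proof -
  have "continuous_on (sphere 0 1) (\<lambda>x::real^'n. x \<bullet> (A *v x))"
    by (intro continuous_intros linear_continuous_on matrix_vector_mul_bounded_linear)
  then obtain v :: "real^'n" where v: "norm v = 1"
    and min: "\<And>x. norm x = 1 \<Longrightarrow> v \<bullet> (A *v v) \<le> x \<bullet> (A *v x)"
    using continuous_attains_inf[of "sphere (0::real^'n) 1"] by force
  define l where "l = v \<bullet> (A *v v)"
  have le: "l * (x \<bullet> x) \<le> x \<bullet> (A *v x)" for x
  proof (cases "x = 0")
    case False
    have "l \<le> (x /\<^sub>R norm x) \<bullet> (A *v (x /\<^sub>R norm x))"
      unfolding l_def using False by (intro min) simp
    also have "\<dots> = (x \<bullet> (A *v x)) / (x \<bullet> x)"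
      by (simp add: matrix_vector_mult_scaleR divide_inverse dot_square_norm power2_eq_square)
    finally show ?thesis
      using False by (simp add: pos_le_divide_eq)
  qed auto
  \<comment> \<open>The shifted matrix is positive semidefinite and its form vanishes at
    \<open>v\<close>, so \<open>psd_kernel\<close> turns minimality into the eigenvector
    equation.\<close>
  define B where "B = A - l *\<^sub>R mat 1"
  have Bv: "B *v x = A *v x - l *\<^sub>R x" for x
    by (simp add: B_def matrix_vector_mult_diff_rdistrib scaleR_matrix_vector_assoc[symmetric])
  have "transpose B = B"
    using sym by (auto simp: B_def transpose_def mat_def vec_eq_iff)
  then have "B *v v = 0"
    by (rule psd_kernel) (use le v in \<open>simp_all add: Bv inner_diff_right l_def dot_square_norm\<close>)
  then have ev: "A *v v = l *\<^sub>R v"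
    by (simp add: Bv)
  have "lambda_min A = l"
    unfolding lambda_min_def
  proof (rule Least_equality)
    show "\<exists>v. v \<noteq> 0 \<and> A *v v = l *\<^sub>R v"
      using v ev by (intro exI[of _ v]) auto
  next
    fix r assume "\<exists>v. v \<noteq> 0 \<and> A *v v = r *\<^sub>R v"
    then obtain u where "u \<noteq> 0" "A *v u = r *\<^sub>R u" by blast
    then show "l \<le> r"
      using le[of u] by simp
  qed
  then show "\<exists>v. norm v = 1 \<and> A *v v = lambda_min A *\<^sub>R v" "lambda_min A * (x \<bullet> x) \<le> x \<bullet> (A *v x)"
    using v ev le by auto
qed

lemma lambda_min_pos:
  fixes A :: "real^'n^'n"
  assumes "transpose A = A" and "\<And>x. x \<noteq> 0 \<Longrightarrow> 0 < x \<bullet> (A *v x)"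
  shows "0 < lambda_min A"
proof -
  obtain v where v: "norm v = 1" "A *v v = lambda_min A *\<^sub>R v"
    using lambda_min_eigenvector[OF assms(1)] by blast
  then have "0 < v \<bullet> (A *v v)"
    by (intro assms) auto
  then show ?thesis
    using v by (simp add: dot_square_norm)
qed

section \<open>Determinants under rank-one updates\<close>

lemma det_row_add_multiples:
  fixes A :: "'a::comm_ring_1^'n^'n"
  assumes "finite S" "k \<notin> S"
  shows "det (\<chi> i. if i = k then v else if i \<in> S then row i A + u $ i *s v else row i A)
    = det (\<chi> i. if i = k then v else row i A)"
  using assms
proof (induction S)
  case (insert l S)
  let ?B = "\<chi> i. if i = k then v else if i \<in> S then row i A + u $ i *s v else row i A"
  have "(\<chi> i. if i = k then v else if i \<in> insert l S then row i A + u $ i *s v else row i A)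
    = (\<chi> i. if i = l then row l ?B + u $ l *s row k ?B else row i ?B)"
    using insert by (auto simp: vec_eq_iff row_def)
  \<comment> \<open>Row \<open>k\<close> of \<open>?B\<close> is \<open>v\<close> itself, so adding
    a multiple of \<open>v\<close> to row \<open>l\<close> is an elementary row operation.\<close>
  then show ?case
    using insert det_row_operation[where i = l and j = k and c = "u $ l" and A = ?B] by auto
qed (simp cong: if_cong)

text \<open>Expanding by multilinearity, every term with \<open>v\<close> in two rows vanishes, so
  only the terms with at most one replaced row survive.\<close>

lemma det_rows_add_multiples:
  fixes A :: "'a::comm_ring_1^'n^'n"
  assumes "finite S"
  shows "det (\<chi> i. if i \<in> S then row i A + u $ i *s v else row i A)
    = det A + (\<Sum>k\<in>S. u $ k * det (\<chi> i. if i = k then v else row i A))"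
  using assms
proof (induction S)
  case empty
  have "(\<chi> i. row i A) = A" by (simp add: vec_eq_iff row_def)
  then show ?case by simp
next
  case (insert k S)
  let ?c = "\<lambda>i. if i \<in> S then row i A + u $ i *s v else row i A"
  have "(\<chi> i. if i \<in> insert k S then row i A + u $ i *s v else row i A)
    = (\<chi> i. if i = k then row k A + u $ k *s v else ?c i)"
    by (simp add: vec_eq_iff)
  also have "det \<dots> = det (\<chi> i. if i = k then row k A else ?c i)
      + u $ k * det (\<chi> i. if i = k then v else ?c i)"
    by (simp only: det_row_add[of k "\<lambda>_. row k A" "\<lambda>_. u $ k *s v" ?c] det_row_mul)
  also have "(\<chi> i. if i = k then row k A else ?c i) = (\<chi> i. ?c i)"
    using insert by (auto simp: vec_eq_iff)
  also have "det (\<chi> i. if i = k then v else ?c i) = det (\<chi> i. if i = k then v else row i A)"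
    using insert by (intro det_row_add_multiples) auto
  finally show ?case
    using insert by (simp add: algebra_simps)
qed

text \<open>The matrix determinant lemma, with \<open>b = A\<^sup>-\<^sup>1 u\<close> given implicitly.\<close>

lemma det_add_outer:
  fixes A :: "real^'n^'n"
  assumes sym: "transpose A = A" and b: "A *v b = u"
  shows "det (A + outer u) = det A * (1 + u \<bullet> b)"
proof -
  \<comment> \<open>By symmetry \<open>A *v b = u\<close> writes \<open>u\<close> as a combination
    of the rows of \<open>A\<close>. Cramer's rule for rows then evaluates each determinant with one
    row replaced by \<open>u\<close>.\<close>
  have u: "(\<Sum>i\<in>UNIV. b $ i *s row i A) = u"
    unfolding b[symmetric] by (subst sym[symmetric])
      (simp add: vec_eq_iff row_def vector_matrix_mult_def mult.commute)
  have "A + outer u = (\<chi> i. if i \<in> UNIV then row i A + u $ i *s u else row i A)"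
    by (simp add: vec_eq_iff outer_def row_def)
  also have "det \<dots> = det A + (\<Sum>k\<in>UNIV. u $ k * det (\<chi> i. if i = k then u else row i A))"
    by (rule det_rows_add_multiples) simp
  also have "\<dots> = det A + (\<Sum>k\<in>UNIV. u $ k * (b $ k * det A))"
    by (simp add: cramer_lemma_transpose[of _ b A, unfolded u])
  also have "\<dots> = det A * (1 + u \<bullet> b)"
    by (simp add: inner_vec_def sum_distrib_left algebra_simps)
  finally show ?thesis .
qed

lemma posdef_invertible:
  fixes A :: "real^'n^'n"
  assumes "\<And>x. x \<noteq> 0 \<Longrightarrow> 0 < x \<bullet> (A *v x)"
  shows "invertible A"
  using assms by (force simp: invertible_iff_kernel_trivial)

text \<open>The factor in the determinant lemma is at least 1, since \<open>u \<bullet> b\<close>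
  equals \<open>b \<bullet> (A *v b)\<close>. The sign of \<open>det A\<close> is supplied by the
  induction in \<open>det_Vmat_ge\<close>.\<close>

lemma det_add_outer_ge:
  fixes A :: "real^'n^'n"
  assumes sym: "transpose A = A" and pd: "\<And>x. x \<noteq> 0 \<Longrightarrow> 0 < x \<bullet> (A *v x)" and "0 \<le> det A"
  shows "det A \<le> det (A + outer u)"
proof -
  define b where "b = matrix_inv A *v u"
  have b: "A *v b = u"
    by (simp add: b_def matrix_vector_mul_assoc matrix_inv_inverts posdef_invertible[OF pd])
  have "0 \<le> b \<bullet> (A *v b)"
    using pd[of b] by (cases "b = 0") auto
  then show ?thesis
    using assms(3) by (simp add: det_add_outer[OF sym b] b inner_commute mult_left_le algebra_simps)
qed

subsection \<open>Trigonometric polynomials of degree two\<close>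

text \<open>Lets distinct angles be counted as distinct complex roots.\<close>

lemma inj_on_cis: "inj_on cis {0..<2 * pi}"
proof (rule inj_onI)
  fix x y assume xy: "x \<in> {0..<2 * pi}" "y \<in> {0..<2 * pi}" "cis x = cis y"
  then obtain n :: int where n: "x = y + 2 * pi * n"
    using sin_cos_eq_iff[of x y] by (auto simp: cis.ctr complex_eq_iff)
  then have "2 * pi * n < 2 * pi * 1" "2 * pi * (-1) < 2 * pi * n"
    using xy unfolding atLeastLessThan_iff by linarith+
  then have "real_of_int n < 1" "-1 < real_of_int n"
    by (simp_all only: mult_less_cancel_left_pos pi_gt_zero mult_pos_pos zero_less_numeral)
  then have "n = 0"
    by linarith
  then show "x = y" using n by simp
qed

text \<open>Multiplied by \<open>2 * z^2\<close> with \<open>z = cis t\<close>, the trigonometric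
  polynomial becomes an algebraic one of degree at most four, which cannot have five roots unless it
  is zero.\<close>

lemma trig_poly2_eq_0:
  fixes c0 c1 s1 c2 s2 :: real
  assumes S: "S \<subseteq> {0..<2 * pi}" "5 \<le> card S"
    and zero: "\<And>t. t \<in> S \<Longrightarrow> c0 + c1 * cos t + s1 * sin t + c2 * cos (2 * t) + s2 * sin (2 * t) = 0"
  shows "c0 = 0 \<and> c1 = 0 \<and> s1 = 0 \<and> c2 = 0 \<and> s2 = 0"
proof -
  \<comment> \<open>The coefficients come from \<open>2 cos t = z + 1/z\<close> and
    \<open>2 sin t = - i (z - 1/z)\<close>, and likewise for \<open>2 t\<close> with
    \<open>z^2\<close>; the doubling avoids halves.\<close>
  define p where "p = [: Complex c2 s2, Complex c1 s1, of_real (2 * c0), Complex c1 (- s1), Complex c2 (- s2) :]"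
  have root: "poly p (cis t) = 0" if "t \<in> S" for t
  proof -
    let ?T = "c0 + c1 * cos t + s1 * sin t + c2 * cos (2 * t) + s2 * sin (2 * t)"
    \<comment> \<open>Here \<open>w\<close> stands for the inverse of \<open>z\<close>, so that the
      identities \<open>zw\<close> replace division.\<close>
    define z w where "z = cis t" and "w = cis (- t)"
    have zw: "w * z\<^sup>2 = z" "w\<^sup>2 * z\<^sup>2 = 1"
      by (simp_all add: z_def w_def Complex.DeMoivre cis_mult)
    have "complex_of_real (2 * ?T) = 2 * c0 + c1 * (z + w) - \<i> * s1 * (z - w)
        + c2 * (z\<^sup>2 + w\<^sup>2) - \<i> * s2 * (z\<^sup>2 - w\<^sup>2)"
      by (simp add: z_def w_def Complex.DeMoivre complex_eq_iff)
    then have "complex_of_real (2 * ?T) * z\<^sup>2 = 2 * c0 * z\<^sup>2 + c1 * (z * z\<^sup>2 + w * z\<^sup>2)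
        - \<i> * s1 * (z * z\<^sup>2 - w * z\<^sup>2) + c2 * (z\<^sup>2 * z\<^sup>2 + w\<^sup>2 * z\<^sup>2)
        - \<i> * s2 * (z\<^sup>2 * z\<^sup>2 - w\<^sup>2 * z\<^sup>2)"
      by (simp only:) (simp only: algebra_simps)
    also have "\<dots> = poly p z"
      unfolding zw by (simp add: p_def Complex_eq algebra_simps power2_eq_square)
    finally have "poly p (cis t) = complex_of_real (2 * ?T) * z\<^sup>2"
      by (simp add: z_def)
    then show ?thesis using zero[OF that] by simp
  qed
  have "p = 0"
  proof (rule ccontr)
    assume "p \<noteq> 0"
    have "5 \<le> card (cis ` S)"
      using S by (simp add: card_image inj_on_subset[OF inj_on_cis])
    also have "\<dots> \<le> card {x. poly p x = 0}"
      using root \<open>p \<noteq> 0\<close> by (intro card_mono poly_roots_finite) auto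
    also have "\<dots> \<le> degree p"
      by (rule card_poly_roots_bound) fact
    also have "\<dots> \<le> 4"
      by (simp add: p_def)
    finally show False by simp
  qed
  then show ?thesis
    by (simp add: p_def complex_eq_iff)
qed

subsection \<open>The regularised Gram matrix\<close>

lemma UNIV_5: "UNIV = {1, 2, 3, 4, 5::5}"
proof -
  have "x \<in> {1, 2, 3, 4, 5}" for x :: 5
  proof (induct x)
    case (of_int z)
    \<comment> \<open>In the type \<open>5\<close> the numeral 5 equals 0, so the case
      \<open>z = 0\<close> is the index 5.\<close>
    then have "z = 0 \<or> z = 1 \<or> z = 2 \<or> z = 3 \<or> z = 4" by fastforce
    then show ?case by auto
  qed
  then show ?thesis by blast
qed

lemma inner_vec_5:
  fixes x y :: "real^5"
  shows "x \<bullet> y = x $ 1 * y $ 1 + x $ 2 * y $ 2 + x $ 3 * y $ 3 + x $ 4 * y $ 4 + x $ 5 * y $ 5"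
  unfolding inner_vec_def UNIV_5 by simp

lemma vector_4:
  "(vector [x, y, z, w] :: real^4) $ 1 = x" "(vector [x, y, z, w] :: real^4) $ 2 = y"
  "(vector [x, y, z, w] :: real^4) $ 3 = z" "(vector [x, y, z, w] :: real^4) $ 4 = w"
  unfolding vector_def by simp_all

lemma vector_5:
  "(vector [x, y, z, w, v] :: real^5) $ 1 = x" "(vector [x, y, z, w, v] :: real^5) $ 2 = y"
  "(vector [x, y, z, w, v] :: real^5) $ 3 = z" "(vector [x, y, z, w, v] :: real^5) $ 4 = w"
  "(vector [x, y, z, w, v] :: real^5) $ 5 = v"
  unfolding vector_def by simp_all

text \<open>One formula covers both branches of \<open>psi\<close>: at \<open>i = 1\<close> all
  differences vanish and the first unit vector remains.\<close>

lemma inner_psi: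
  "x \<bullet> psi a i = x $ 1 + x $ 2 * (cos (a i) - cos (a 1)) + x $ 3 * (sin (a i) - sin (a 1))
    + x $ 4 * (cos (2 * a i) - cos (2 * a 1)) + x $ 5 * (sin (2 * a i) - sin (2 * a 1))"
  by (simp add: inner_vec_5 psi_def vector_4 vector_5 zfeat_def Let_def)

lemma transpose_outer: "transpose (outer u) = outer u"
  by (simp add: transpose_def outer_def vec_eq_iff mult.commute)

lemma gram_Suc: "gram a (Suc n) = gram a n + outer (psi a (Suc n))"
  by (simp add: gram_def)

lemma transpose_gram: "transpose (gram a n) = gram a n"
  by (induction n) (auto simp: gram_Suc transpose_outer gram_def transpose_def vec_eq_iff outer_def mult.commute)

lemma inner_gram: "x \<bullet> (gram a n *v x) = (\<Sum>i = 1..n. (x \<bullet> psi a i)\<^sup>2)"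
proof (induction n)
  case (Suc n)
  then show ?case
    by (simp add: gram_Suc matrix_vector_mult_add_rdistrib inner_add_right inner_outer
        inner_commute[of "psi a (Suc n)"] power2_eq_square)
qed (simp add: gram_def)

lemma inner_Lam:
  "x \<bullet> (Lam l *v x) = l * ((x $ 2)\<^sup>2 + (x $ 3)\<^sup>2 + (x $ 4)\<^sup>2 + (x $ 5)\<^sup>2)"
proof -
  have "(Lam l *v x) $ i = (if i = 1 then 0 else l * x $ i)" for i
    by (simp add: Lam_def matrix_vector_mult_def if_distrib[of "\<lambda>a. a * _"] cong: if_cong)
  then show ?thesis
    by (simp add: inner_vec_5 power2_eq_square algebra_simps)
qed

lemma transpose_Vmat: "transpose (Vmat c a n) = Vmat c a n"
proof -
  have "transpose (Vmat c a n) = Lam (lam c) + transpose (gram a n)"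
    by (auto simp: Vmat_def transpose_def Lam_def vec_eq_iff)
  then show ?thesis
    by (simp add: transpose_gram Vmat_def)
qed

lemma inner_Vmat: "x \<bullet> (Vmat c a n *v x) = x \<bullet> (Lam (lam c) *v x) + x \<bullet> (gram a n *v x)"
  by (simp add: Vmat_def matrix_vector_mult_add_rdistrib inner_add_right)

lemma inner_gram_le_inner_Vmat:
  assumes "0 < lam c"
  shows "x \<bullet> (gram a n *v x) \<le> x \<bullet> (Vmat c a n *v x)"
  using assms by (simp add: inner_Vmat inner_Lam)

text \<open>The regularizer controls coordinates 2 to 5 only. The first sample, whose regressor is
  the first unit vector, controls the remaining one; hence \<open>1 \<le> n\<close>.\<close>

lemma Vmat_posdef:
  assumes "0 < lam c" "1 \<le> n" "x \<noteq> 0"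
  shows "0 < x \<bullet> (Vmat c a n *v x)"
proof -
  have "(x $ 1)\<^sup>2 = (x \<bullet> psi a 1)\<^sup>2"
    by (simp add: inner_psi)
  also have "\<dots> \<le> (\<Sum>i = 1..n. (x \<bullet> psi a i)\<^sup>2)"
    using assms by (intro member_le_sum) auto
  finally have 1: "(x $ 1)\<^sup>2 \<le> x \<bullet> (gram a n *v x)"
    by (simp add: inner_gram)
  let ?q = "(x $ 2)\<^sup>2 + (x $ 3)\<^sup>2 + (x $ 4)\<^sup>2 + (x $ 5)\<^sup>2"
  have q: "0 \<le> ?q" by simp
  have "0 < x \<bullet> x" using assms by simp
  then have "0 < (x $ 1)\<^sup>2 + ?q"
    by (simp add: inner_vec_5 power2_eq_square)
  then have "0 < (x $ 1)\<^sup>2 + lam c * ?q"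
  proof (cases "?q = 0")
    case False
    then have "0 < lam c * ?q" using q assms(1) by (intro mult_pos_pos) linarith+
    then show ?thesis by (intro add_nonneg_pos) auto
  qed simp
  then show ?thesis
    using 1 by (simp add: inner_Vmat inner_Lam)
qed

text \<open>Identifies the denominator in \<open>beta\<close> with the one in \<open>D_m\<close>,
  whatever the first bearing is.\<close>

lemma Vmat_1: "Vmat c a 1 = V_one c"
proof -
  have "Vmat c a 1 $ i $ j = V_one c $ i $ j" for i j
    using UNIV_I[of i] UNIV_I[of j] unfolding UNIV_5
    by (auto simp: Vmat_def gram_def Lam_def V_one_def outer_def psi_def vector_5)
  then show ?thesis by (simp add: vec_eq_iff)
qed

lemma det_V_one_pos:
  assumes "0 < lam c"
  shows "0 < det (V_one c)"
  using assms by (subst det_diagonal) (auto simp: V_one_def intro!: prod_pos)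

text \<open>Each further sample is a rank-one update of a positive definite matrix, which cannot
  lower the determinant.\<close>

lemma det_Vmat_ge:
  assumes "0 < lam c" "1 \<le> n"
  shows "det (V_one c) \<le> det (Vmat c a n)"
  using assms(2)
proof (induction n rule: dec_induct)
  case base
  show ?case by (simp only: Vmat_1)
next
  case (step n)
  have "Vmat c a (Suc n) = Vmat c a n + outer (psi a (Suc n))"
    by (simp add: Vmat_def gram_Suc add.assoc)
  moreover have "det (Vmat c a n) \<le> det (Vmat c a n + outer (psi a (Suc n)))"
    using assms(1) step det_V_one_pos[of c]
    by (intro det_add_outer_ge transpose_Vmat Vmat_posdef) auto
  ultimately show ?case
    using step by simp
qed

lemma D_m_ge_1:
  assumes "0 < lam c" "1 \<le> m"
  shows "1 \<le> D_m c m abar"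
  using det_Vmat_ge[OF assms] det_V_one_pos[OF assms(1)] by (simp add: D_m_def)

text \<open>A vector in the kernel of the form is orthogonal to all regressors. It thus gives a
  trigonometric polynomial of degree two with at least five zeros in one period.\<close>

lemma gram_posdef:
  assumes "a ` {1..n} \<subseteq> {0..<2 * pi}" "inj_on a {1..n}" "5 \<le> n" "x \<noteq> 0"
  shows "0 < x \<bullet> (gram a n *v x)"
proof (rule ccontr)
  assume "\<not> ?thesis"
  then have "(\<Sum>i = 1..n. (x \<bullet> psi a i)\<^sup>2) = 0"
    by (simp add: inner_gram) (meson antisym sum_nonneg not_less zero_le_power2)
  then have zero: "x \<bullet> psi a i = 0" if "i \<in> {1..n}" for i
    using that by (simp add: sum_nonneg_eq_0_iff)
  have x1: "x $ 1 = 0"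
    using zero[of 1] assms by (simp add: inner_psi)
  \<comment> \<open>The regressors are centered at the first bearing; expanding the differences
    moves the features of \<open>a 1\<close> into the constant coefficient.\<close>
  have "(x $ 1 - x $ 2 * cos (a 1) - x $ 3 * sin (a 1) - x $ 4 * cos (2 * a 1) - x $ 5 * sin (2 * a 1)) = 0
    \<and> x $ 2 = 0 \<and> x $ 3 = 0 \<and> x $ 4 = 0 \<and> x $ 5 = 0"
  proof (rule trig_poly2_eq_0)
    show "a ` {1..n} \<subseteq> {0..<2 * pi}" using assms by blast
    show "5 \<le> card (a ` {1..n})" using assms by (simp add: card_image)
    fix t assume "t \<in> a ` {1..n}"
    then obtain i where "i \<in> {1..n}" "t = a i" by blast
    then show "x $ 1 - x $ 2 * cos (a 1) - x $ 3 * sin (a 1) - x $ 4 * cos (2 * a 1) - x $ 5 * sin (2 * a 1)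
      + x $ 2 * cos t + x $ 3 * sin t + x $ 4 * cos (2 * t) + x $ 5 * sin (2 * t) = 0"
      using zero[of i] by (simp add: inner_psi algebra_simps)
  qed
  with x1 have "x \<bullet> x = 0" by (simp add: inner_vec_5)
  with assms show False by simp
qed

lemma lambda_min_gram_pos:
  assumes "a ` {1..n} \<subseteq> {0..<2 * pi}" "inj_on a {1..n}" "5 \<le> n"
  shows "0 < lambda_min ((1 / real n) *\<^sub>R gram a n)"
proof (rule lambda_min_pos)
  show "transpose ((1 / real n) *\<^sub>R gram a n) = (1 / real n) *\<^sub>R gram a n"
    by (metis transpose_gram transpose_scalar)
  show "0 < x \<bullet> (((1 / real n) *\<^sub>R gram a n) *v x)" if "x \<noteq> 0" for x
    using gram_posdef[OF assms that] assms(3)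
    by (simp add: scaleR_matrix_vector_assoc[symmetric])
qed

lemma lambda_min_gram_le:
  assumes "1 \<le> n"
  shows "real n * lambda_min ((1 / real n) *\<^sub>R gram a n) * (x \<bullet> x) \<le> x \<bullet> (gram a n *v x)"
proof -
  have "lambda_min ((1 / real n) *\<^sub>R gram a n) * (x \<bullet> x) \<le> x \<bullet> (((1 / real n) *\<^sub>R gram a n) *v x)"
    by (rule lambda_min_le) (metis transpose_gram transpose_scalar)
  then show ?thesis
    using assms by (simp add: scaleR_matrix_vector_assoc[symmetric] field_simps)
qed

subsection \<open>Size of the confidence set\<close>

lemma Gmat_mult: "Gmat c *v x = (1 / rho c) *\<^sub>R vector [x $ 2, x $ 3]"
proof -
  have "(vector [vector [0, 1, 0, 0, 0], vector [0, 0, 1, 0, 0]] :: real^5^2) *v x = vector [x $ 2, x $ 3]"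
    unfolding vec_eq_iff forall_2
    by (simp add: matrix_vector_mul_component inner_vec_5 vector_5)
  then show ?thesis
    by (simp add: Gmat_def scaleR_matrix_vector_assoc[symmetric])
qed

text \<open>Up to the factor \<open>1 / rho c\<close>, \<open>Gmat c\<close> is a coordinate
  projection.\<close>

lemma inner_Gmat_le:
  assumes "0 < rho c"
  shows "(rho c)\<^sup>2 * ((Gmat c *v x) \<bullet> (Gmat c *v x)) \<le> x \<bullet> x"
proof -
  have "(rho c)\<^sup>2 * ((Gmat c *v x) \<bullet> (Gmat c *v x)) = (x $ 2)\<^sup>2 + (x $ 3)\<^sup>2"
    using assms by (simp add: Gmat_mult inner_vec_def sum_2 power2_eq_square field_simps)
  also have "\<dots> \<le> x \<bullet> x"
    by (simp add: inner_vec_5 power2_eq_square)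
  finally show ?thesis .
qed

text \<open>Surjectivity makes the transpose injective, which is what invertibility of
  \<open>Pmat\<close> rests on.\<close>

lemma surj_Gmat:
  assumes "0 < rho c"
  shows "\<exists>x. Gmat c *v x = w"
proof
  show "Gmat c *v vector [0, rho c * w $ 1, rho c * w $ 2, 0, 0] = w"
    using assms unfolding Gmat_mult vec_eq_iff forall_2 by (simp add: vector_5)
qed

text \<open>With \<open>x = V\<^sup>-\<^sup>1 G\<^sup>T w\<close> one has \<open>P w = G x\<close> and \<open>w \<bullet> P w = x \<bullet> V x\<close>, so no ordering of
  inverse matrices is needed.\<close>

lemma Pmat_factor:
  assumes V: "invertible (Vmat c a n)"
  obtains x where "Pmat c a n *v w = Gmat c *v x" "Vmat c a n *v x = transpose (Gmat c) *v w"
    "w \<bullet> (Pmat c a n *v w) = x \<bullet> (Vmat c a n *v x)"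
proof -
  define x where "x = matrix_inv (Vmat c a n) *v (transpose (Gmat c) *v w)"
  have P: "Pmat c a n *v w = Gmat c *v x"
    by (simp only: Pmat_def x_def matrix_vector_mul_assoc matrix_mul_assoc)
  have Vx: "Vmat c a n *v x = transpose (Gmat c) *v w"
    by (simp only: x_def matrix_vector_mul_assoc matrix_mul_assoc matrix_inv_inverts[OF V] matrix_mul_lid)
  have "w \<bullet> (Pmat c a n *v w) = x \<bullet> (Vmat c a n *v x)"
    unfolding P Vx by (metis dot_lmul_matrix inner_commute transpose_matrix_vector)
  with P Vx show ?thesis by (rule that)
qed

text \<open>Writing \<open>d = P w = G x\<close> as in \<open>Pmat_factor\<close>, the form of the
  inverse at \<open>d\<close> is \<open>x \<bullet> V x\<close>. This is at least
  \<open>K * (x \<bullet> x)\<close>, and \<open>G\<close> shrinks lengths by at least the factor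
  \<open>rho c\<close>.\<close>

lemma inner_matrix_inv_Pmat_ge:
  assumes rho: "0 < rho c" and lam: "0 < lam c" and n: "1 \<le> n"
    and K: "0 < K" "\<And>x. K * (x \<bullet> x) \<le> x \<bullet> (gram a n *v x)"
  shows "(rho c)\<^sup>2 * K * (d \<bullet> d) \<le> d \<bullet> (matrix_inv (Pmat c a n) *v d)"
proof -
  have VK: "K * (x \<bullet> x) \<le> x \<bullet> (Vmat c a n *v x)" for x
    using K(2) inner_gram_le_inner_Vmat[OF lam] by (rule order_trans)
  have V: "invertible (Vmat c a n)"
    by (intro posdef_invertible Vmat_posdef lam n)
  \<comment> \<open>If \<open>P w = 0\<close>, the associated \<open>x\<close> vanishes, so
    \<open>w\<close> is orthogonal to the range of \<open>G\<close>, which is the whole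
    plane.\<close>
  have "w = 0" if "Pmat c a n *v w = 0" for w
  proof -
    obtain x where x: "Vmat c a n *v x = transpose (Gmat c) *v w"
      "w \<bullet> (Pmat c a n *v w) = x \<bullet> (Vmat c a n *v x)"
      using Pmat_factor[OF V] by metis
    have "x \<bullet> x \<le> 0"
      using VK[of x] x(2) K(1) that by (simp add: mult_le_0_iff)
    then have "x = 0"
      using inner_gt_zero_iff[of x] by linarith
    then have *: "w v* Gmat c = 0" using x(1) by simp
    obtain u where "Gmat c *v u = w" using surj_Gmat[OF rho] by blast
    then have "w \<bullet> w = 0"
      using dot_lmul_matrix[of w "Gmat c" u] * by simp
    then show ?thesis by simp
  qed
  then have "invertible (Pmat c a n)"
    by (simp add: invertible_iff_kernel_trivial)
  then have P: "Pmat c a n *v (matrix_inv (Pmat c a n) *v d) = d"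
    by (simp add: matrix_vector_mul_assoc matrix_inv_inverts)
  define w where "w = matrix_inv (Pmat c a n) *v d"
  obtain x where x: "d = Gmat c *v x" "w \<bullet> d = x \<bullet> (Vmat c a n *v x)"
    using Pmat_factor[OF V, of w] P by (metis w_def)
  have "(rho c)\<^sup>2 * K * (d \<bullet> d) = K * ((rho c)\<^sup>2 * ((Gmat c *v x) \<bullet> (Gmat c *v x)))"
    by (simp add: x(1))
  also have "\<dots> \<le> K * (x \<bullet> x)"
    using K(1) inner_Gmat_le[OF rho] by simp
  also have "\<dots> \<le> w \<bullet> d"
    using VK by (simp add: x(2))
  finally show ?thesis
    by (simp add: w_def inner_commute)
qed

lemma closed_conf_set: "closed (conf_set c d a y n)"
  unfolding conf_set_def
  by (intro closed_Collect_le continuous_intros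
      bounded_linear.continuous_on[OF matrix_vector_mul_bounded_linear])

text \<open>The set is defined through the square of \<open>beta\<close>; nonnegativity of
  \<open>beta\<close> is what permits taking roots.\<close>

lemma conf_set_subset_cball:
  assumes rho: "0 < rho c" and lam: "0 < lam c" and n: "1 \<le> n"
    and K: "0 < K" "\<And>x. K * (x \<bullet> x) \<le> x \<bullet> (gram a n *v x)" and beta: "0 \<le> beta c d a n"
  shows "conf_set c d a y n \<subseteq> cball (grad_est c a y n) (beta c d a n / (rho c * sqrt K))"
proof
  fix g assume g: "g \<in> conf_set c d a y n"
  let ?d = "g - grad_est c a y n"
  have "(rho c * sqrt K * norm ?d)\<^sup>2 = (rho c)\<^sup>2 * K * (?d \<bullet> ?d)"
    using K(1) by (simp add: power_mult_distrib dot_square_norm)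
  also have "\<dots> \<le> (beta c d a n)\<^sup>2"
    using inner_matrix_inv_Pmat_ge[OF rho lam n K, of ?d] g by (simp add: conf_set_def)
  finally have "rho c * sqrt K * norm ?d \<le> beta c d a n"
    using beta by (rule power2_le_imp_le)
  then show "g \<in> cball (grad_est c a y n) (beta c d a n / (rho c * sqrt K))"
    using rho K(1) by (simp add: dist_norm norm_minus_commute pos_le_divide_eq mult.commute)
qed

text \<open>\<open>LEAST\<close> and \<open>GREATEST\<close> over the reals carry information only
  when the extremum is attained; compactness and nonemptiness guarantee this.\<close>

lemma gamma_attained:
  assumes "compact (conf_set c d a y n)" "conf_set c d a y n \<noteq> {}"
  shows gamma_minus_attained: "gamma_minus c d a y n \<in> norm ` conf_set c d a y n"
    and gamma_plus_attained: "gamma_plus c d a y n \<in> norm ` conf_set c d a y n"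
proof -
  let ?N = "norm ` conf_set c d a y n"
  have N: "compact ?N" "?N \<noteq> {}"
    using assms by (auto intro!: compact_continuous_image continuous_intros)
  obtain l where l: "l \<in> ?N" "\<forall>r\<in>?N. l \<le> r"
    using compact_attains_inf[OF N] by blast
  then have "gamma_minus c d a y n = l"
    unfolding gamma_minus_def by (intro Least_equality) auto
  with l show "gamma_minus c d a y n \<in> ?N" by simp
  obtain u where u: "u \<in> ?N" "\<forall>r\<in>?N. r \<le> u"
    using compact_attains_sup[OF N] by blast
  then have "gamma_plus c d a y n = u"
    unfolding gamma_plus_def by (intro Greatest_equality) auto
  with u show "gamma_plus c d a y n \<in> ?N" by simp
qed

text \<open>Both extremal norms belong to points of one ball, and the norm is 1-Lipschitz, so the
  gap is at most the diameter.\<close>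

lemma gamma_gap_le:
  assumes sub: "conf_set c d a y n \<subseteq> cball z r" and ne: "conf_set c d a y n \<noteq> {}"
  shows "gamma_plus c d a y n - gamma_minus c d a y n \<le> 2 * r"
proof -
  have cpt: "compact (conf_set c d a y n)"
    using closed_conf_set sub bounded_subset[OF bounded_cball] by (auto simp: compact_eq_bounded_closed)
  obtain g h where gh: "g \<in> conf_set c d a y n" "gamma_plus c d a y n = norm g"
    "h \<in> conf_set c d a y n" "gamma_minus c d a y n = norm h"
    using gamma_minus_attained[OF cpt ne] gamma_plus_attained[OF cpt ne] by blast
  have "norm g - norm h \<le> dist g h"
    by (simp add: dist_norm norm_triangle_ineq2)
  also have "\<dots> \<le> dist z g + dist z h"
    by (metis dist_commute dist_triangle)
  also have "\<dots> \<le> 2 * r"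
    using subsetD[OF sub gh(1)] subsetD[OF sub gh(3)] by simp
  finally show ?thesis using gh by simp
qed

subsection \<open>The candidate schedule\<close>

lemma inj_on_bearing:
  assumes "2 \<le> m" "0 < abar"
  shows "inj_on (bearing m abar) A"
  using assms by (auto intro!: inj_onI simp: bearing_def divide_simps)

lemma bearing_range:
  assumes "2 \<le> m" "0 < abar"
  shows "bearing m abar ` {1..m} \<subseteq> {0..abar}"
  using assms by (auto simp: bearing_def divide_simps mult_right_mono)

text \<open>The strict bound \<open>abar < 2 * pi\<close> keeps the last bearing from coinciding
  with the first on the circle, so all \<open>m\<close> directions are distinct.\<close>

lemma kappa_m_pos:
  assumes "5 \<le> m" "0 < abar" "abar < 2 * pi"
  shows "0 < kappa_m m abar"
  unfolding kappa_m_def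
  using assms bearing_range[of m abar] inj_on_bearing[of m abar]
  by (intro lambda_min_gram_pos) force+

text \<open>Both logarithms have arguments at least 1, because \<open>D_m\<close> is at least 1 and
  \<open>d < 1\<close>.\<close>

lemma beta_bar_nonneg:
  assumes "0 \<le> sig c" "0 < rho c" "0 < M3bd c" "0 < lam c" "1 \<le> m" "0 < d" "d < 1"
  shows "0 \<le> beta_bar c m abar d"
proof -
  have "1 \<le> sqrt (D_m c m abar)"
    using D_m_ge_1[of c m abar] assms by simp
  then have "d \<le> 2 * sqrt (D_m c m abar)"
    using \<open>d < 1\<close> by linarith
  then have "0 \<le> ln (2 * sqrt (D_m c m abar) / d)" "0 \<le> ln (4 / d)"
    using assms by (simp_all add: pos_le_divide_eq)
  then show ?thesis
    using assms by (simp add: beta_bar_def S_xi_def b_rho_def)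
qed

lemma gram_cong:
  assumes "\<And>i. i \<in> {1..n} \<Longrightarrow> a i = b i"
  shows "gram a n = gram b n"
  unfolding gram_def
proof (rule sum.cong)
  fix i assume "i \<in> {1..n}"
  \<comment> \<open>Every regressor also depends on the first bearing, and index 1 lies in any
    nonempty range \<open>{1..n}\<close>.\<close>
  then have "a i = b i" "a 1 = b 1" using assms by auto
  then have "psi a i = psi b i" by (simp add: psi_def)
  then show "outer (psi a i) = outer (psi b i)" by simp
qed simp

text \<open>At sample \<open>m\<close> the confidence radius depends on the bearings alone, so it
  takes its deterministic design value.\<close>

lemma beta_eq_beta_bar:
  assumes "\<And>i. i \<in> {1..m} \<Longrightarrow> a i = bearing m abar i"
  shows "beta c d a m = beta_bar c m abar d"
proof -
  have "Vmat c a m = Vmat c (bearing m abar) m"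
    using gram_cong[of m a, OF assms] by (simp add: Vmat_def)
  then show ?thesis
    unfolding beta_def beta_bar_def D_m_def Vmat_1 by (simp add: real_sqrt_divide mult.commute)
qed

lemma scan_angle_bearing_le:
  assumes a: "\<And>i. i \<in> {1..m} \<Longrightarrow> a i = bearing m abar i" and "n \<le> m" "2 \<le> m" "0 < abar"
  shows "scan_angle a n \<le> abar"
proof -
  have "\<bar>a i - a (i - 1)\<bar> = abar / (real m - 1)" if "i \<in> {2..n}" for i
  proof -
    have "a i = bearing m abar i" "a (i - 1) = bearing m abar (i - 1)"
      using that \<open>n \<le> m\<close> by (auto intro!: a)
    then have "a i - a (i - 1) = abar / (real m - 1)"
      using that by (simp add: bearing_def of_nat_diff diff_divide_distrib[symmetric] algebra_simps)
    then show ?thesis using assms by simp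
  qed
  \<comment> \<open>For \<open>n = 0\<close> the sum is empty and the truncated \<open>n - 1\<close>
    is 0 as well.\<close>
  then have "scan_angle a n = real (n - 1) * (abar / (real m - 1))"
    by (simp add: scan_angle_def)
  also have "\<dots> \<le> real (m - 1) * (abar / (real m - 1))"
    using assms by (intro mult_right_mono) auto
  also have "\<dots> = abar"
    using assms by (simp add: of_nat_diff)
  finally show ?thesis .
qed

section \<open>Termination of an episode by sample \<open>m\<close>\<close>

theorem theorem2:
  fixes M :: "'w measure" and F :: "real^2 \<Rightarrow> real" and p0 pstar :: "real^2"
    and \<Delta>0 abar \<epsilon> \<eta> :: real and c :: params and \<delta> :: "nat \<Rightarrow> real" and m k :: nat
    and p :: "nat \<Rightarrow> 'w \<Rightarrow> real^2" and \<theta> :: "nat \<Rightarrow> 'w \<Rightarrow> real"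
    and \<alpha> w y :: "nat \<Rightarrow> nat \<Rightarrow> 'w \<Rightarrow> real" and \<tau> :: "nat \<Rightarrow> 'w \<Rightarrow> enat"
    and H :: "nat \<Rightarrow> nat \<Rightarrow> 'w measure"
  assumes model: "scan_model M F p0 pstar \<Delta>0 c m abar \<epsilon> \<eta> \<delta> p \<theta> \<alpha> w y \<tau> H"
    and abar: "0 < abar" "abar < 2 * pi"
    and m: "5 \<le> m"
    and lam: "0 < lam c"
    and eps: "0 < \<epsilon>"
    and eta: "0 < \<eta>" "\<eta> < 1"
    and delta: "0 < \<delta> k" "\<delta> k < 1"
    and design: "rho_bar c m abar (\<delta> k) \<le> (1 - \<eta>) * \<epsilon> / 4"
  shows "\<forall>\<omega> \<in> {\<omega> \<in> space M. \<forall>n \<in> {1..m}.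
             transpose (rot (\<theta> k \<omega>)) *v grad F (p k \<omega>)
               \<in> conf_set c (\<delta> k) (\<lambda>i. \<alpha> k i \<omega>) (\<lambda>i. y k i \<omega>) n}.
           (\<exists>n \<in> {1..m}.
              gamma_plus c (\<delta> k) (\<lambda>i. \<alpha> k i \<omega>) (\<lambda>i. y k i \<omega>) n \<le> \<epsilon> \<or>
              gamma_minus c (\<delta> k) (\<lambda>i. \<alpha> k i \<omega>) (\<lambda>i. y k i \<omega>) n
                \<ge> \<eta> * gamma_plus c (\<delta> k) (\<lambda>i. \<alpha> k i \<omega>) (\<lambda>i. y k i \<omega>) n) \<and>
           \<tau> k \<omega> \<le> enat m \<and>
           scan_angle (\<lambda>i. \<alpha> k i \<omega>) (the_enat (\<tau> k \<omega>)) \<le> abar \<and> abar < 2 * pi"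
proof
  fix \<omega>
  assume \<omega>: "\<omega> \<in> {\<omega> \<in> space M. \<forall>n \<in> {1..m}.
             transpose (rot (\<theta> k \<omega>)) *v grad F (p k \<omega>)
               \<in> conf_set c (\<delta> k) (\<lambda>i. \<alpha> k i \<omega>) (\<lambda>i. y k i \<omega>) n}"
  interpret scan_model M F p0 pstar \<Delta>0 c m abar \<epsilon> \<eta> \<delta> p \<theta> \<alpha> w y \<tau> H
    by (rule model)
  define a where "a = (\<lambda>i. \<alpha> k i \<omega>)"
  define y' where "y' = (\<lambda>i. y k i \<omega>)"
  have a: "a i = bearing m abar i" if "i \<in> {1..m}" for i
    using bearing_eq[OF that] \<omega> by (simp add: a_def)
  \<comment> \<open>The confidence event supplies nonemptiness: the local gradient is a member at
    \<open>n = m\<close>.\<close>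
  have ne: "conf_set c (\<delta> k) a y' m \<noteq> {}"
    using \<omega> m by (force simp: a_def y'_def)
  have kappa: "0 < kappa_m m abar"
    by (rule kappa_m_pos[OF m abar])
  have gram: "real m * kappa_m m abar * (x \<bullet> x) \<le> x \<bullet> (gram a m *v x)" for x
    using lambda_min_gram_le[of m "bearing m abar" x] m gram_cong[of m a, OF a]
    by (simp add: kappa_m_def)
  have beta: "beta c (\<delta> k) a m = beta_bar c m abar (\<delta> k)"
    by (rule beta_eq_beta_bar[OF a])
  have "conf_set c (\<delta> k) a y' m \<subseteq> cball (grad_est c a y' m)
      (beta c (\<delta> k) a m / (rho c * sqrt (real m * kappa_m m abar)))"
    by (rule conf_set_subset_cball)
      (use rho_pos lam m kappa gram beta beta_bar_nonneg sig_nonneg consts_pos delta in auto)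
  \<comment> \<open>After rewriting \<open>beta\<close> to its design value, the radius of the ball
    is exactly \<open>rho_bar\<close>.\<close>
  then have "gamma_plus c (\<delta> k) a y' m - gamma_minus c (\<delta> k) a y' m \<le> 2 * rho_bar c m abar (\<delta> k)"
    unfolding beta rho_bar_def[symmetric] by (rule gamma_gap_le[OF _ ne])
  also have "\<dots> \<le> (1 - \<eta>) * \<epsilon> / 2"
    using design by simp
  also have "\<dots> \<le> (1 - \<eta>) * \<epsilon>"
    using eta eps by simp
  finally have gap: "gamma_plus c (\<delta> k) a y' m - gamma_minus c (\<delta> k) a y' m \<le> (1 - \<eta>) * \<epsilon>" .
  have stop: "stop_cond c \<epsilon> \<eta> (\<delta> k) a y' m"
  proof (cases "gamma_plus c (\<delta> k) a y' m \<le> \<epsilon>")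
    case False
    \<comment> \<open>With \<gamma>+ above \<epsilon>, the absolute gap bound becomes relative: the
      gap is at most \<open>1 - \<eta>\<close> times \<gamma>+.\<close>
    then have "(1 - \<eta>) * \<epsilon> \<le> (1 - \<eta>) * gamma_plus c (\<delta> k) a y' m"
      using eta by (intro mult_left_mono) auto
    with gap have "\<eta> * gamma_plus c (\<delta> k) a y' m \<le> gamma_minus c (\<delta> k) a y' m"
      by (simp add: algebra_simps)
    then show ?thesis by (simp add: stop_cond_def)
  qed (simp add: stop_cond_def)
  have tau: "\<tau> k \<omega> \<le> enat m"
    unfolding \<tau>_eq stop_time_def a_def[symmetric] y'_def[symmetric]
    using stop m by (intro INF_lower) auto
  \<comment> \<open>The bound by \<open>enat m\<close> excludes the infinite value, at which
    \<open>the_enat\<close> would say nothing.\<close>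
  then have "the_enat (\<tau> k \<omega>) \<le> m"
    by (cases "\<tau> k \<omega>") auto
  then have "scan_angle a (the_enat (\<tau> k \<omega>)) \<le> abar"
    using m abar by (intro scan_angle_bearing_le[OF a]) auto
  moreover have "m \<in> {1..m}" using m by simp
  ultimately show "(\<exists>n \<in> {1..m}.
              gamma_plus c (\<delta> k) (\<lambda>i. \<alpha> k i \<omega>) (\<lambda>i. y k i \<omega>) n \<le> \<epsilon> \<or>
              gamma_minus c (\<delta> k) (\<lambda>i. \<alpha> k i \<omega>) (\<lambda>i. y k i \<omega>) n
                \<ge> \<eta> * gamma_plus c (\<delta> k) (\<lambda>i. \<alpha> k i \<omega>) (\<lambda>i. y k i \<omega>) n) \<and>
           \<tau> k \<omega> \<le> enat m \<and>
           scan_angle (\<lambda>i. \<alpha> k i \<omega>) (the_enat (\<tau> k \<omega>)) \<le> abar \<and> abar < 2 * pi"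
    using stop tau abar unfolding stop_cond_def a_def y'_def by blast
qed

end
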